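(* Let $n\ge 2$, $N\ge 1$ and $\{U\}=(U_1,\dots,U_N)\in[SL(n,\mathbb{C})]^N$. Suppose $U_NU_1\cdots U_{N-1}$ is diagonalizable, and write $U_NU_1\cdots U_{N-1}=Q\Lambda Q^{-1}$ with $\Lambda=\mathrm{diag}(\mu_1,\dots,\mu_n)$ and $\det Q=1$. For any $P_k\in SL(n,\mathbb{C})$, $k=1,\dots,N$, define $$V_k=\begin{cases}(U_k\cdots U_{N-1})\,Q\,(\Lambda\Lambda^\dagger)^{-\frac{N-k}{2N}}P_k, & k=1,\dots,N-1,\\ QP_k, & k=N.\end{cases}$$ Let $\mathcal{V}=\mathrm{diag}(V_1,\dots,V_N)$, and let $\mathcal{T},\mathcal{S}$ be the block matrices defined in the context. Then $\mathcal{V}^{-1}\mathcal{T}\mathcal{S}$ is unitary. In this case, with $\widetilde U_k=V_k^{-1}U_kV_{k+1}$ for $k=1,\dots,N$ (where $V_{N+1}=V_1$) and $\{\widetilde U\}=(\widetilde U_1,\dots,\widetilde U_N)$, $$\|\{\widetilde U\}\|=\sqrt{N\Big(\sum_{j=1}^n|\mu_j|^{2/N}\Big)}.$$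
   Context: $SL(n,\mathbb{C})$ is the group of complex $n\times n$ matrices of determinant $1$. For $\{U\}=(U_1,\dots,U_N)\in[\mathbb{C}^{n\times n}]^N$, $\|\{U\}\|=\big(\sum_{k=1}^N\|U_k\|_F^2\big)^{1/2}$, where $\|A\|_F^2=\mathrm{tr}(AA^\dagger)$ is the squared Frobenius norm and $\dagger$ is the conjugate transpose. The product $U_NU_1\cdots U_{N-1}$ means $U_N$ times $U_1U_2\cdots U_{N-1}$ (it is $U_1$ if $N=1$). Since $\Lambda$ is an invertible diagonal matrix, $\Lambda\Lambda^\dagger=\mathrm{diag}(|\mu_1|^2,\dots,|\mu_n|^2)$ is positive definite and its real powers are taken entrywise on the diagonal. Define the $nN\times nN$ block matrices (with $N\times N$ blocks of size $n\times n$) $$\mathcal{T}=\mathrm{diag}(U_1U_2\cdots U_{N-1}Q,\;U_2\cdots U_{N-1}Q,\;\dots,\;U_{N-1}Q,\;Q),$$ $$\mathcal{S}=\frac{1}{\sqrt N}\begin{pmatrix}\Lambda_1^{-(N-1)}&\Lambda_2^{-(N-1)}&\cdots&\Lambda_N^{-(N-1)}\\ \Lambda_1^{-(N-2)}&\Lambda_2^{-(N-2)}&\cdots&\Lambda_N^{-(N-2)}\\ \vdots&\vdots&\ddots&\vdots\\ \Lambda_1^{-1}&\Lambda_2^{-1}&\cdots&\Lambda_N^{-1}\\ I&I&\cdots&I\end{pmatrix},$$ where $I$ is the $n\times n$ identity matrix, $\Lambda_k=\mathrm{diag}(\mu_1^{(k)},\dots,\mu_n^{(k)})$ for $k=1,\dots,N$,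 and for each $j$, $\mu_j^{(1)},\dots,\mu_j^{(N)}$ are all the distinct complex $N$th roots of $\mu_j$.
   Formalization: The matrices P_k are taken in SU(n) (unitary with determinant 1) instead of SL(n,C): for non-unitary P_k the claim fails, e.g. n=2, N=1, U_1=Q=Λ=I, P_1=diag(2,1/2); unitarity of V^{-1}TS holds exactly when all P_k are unitary. *)

theory Defs
  imports
    Complex_Main
    "Jordan_Normal_Form.Schur_Decomposition"
    "Jordan_Normal_Form.Gauss_Jordan_Elimination"
begin

(* Tuples of matrices are functions on the indices 1..N, whose values outside this range
   are irrelevant.  Rows and columns of a single matrix are numbered from 0. *)

(* Meaningful only for invertible A: mat_inverse returns None on singular matrices. *)
definition mat_inv :: "complex mat \<Rightarrow> complex mat" where
  "mat_inv A = the (mat_inverse A)"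

definition unitary_mat :: "complex mat \<Rightarrow> bool" where
  "unitary_mat A \<longleftrightarrow> square_mat A \<and>
     A * mat_adjoint A = 1\<^sub>m (dim_row A) \<and> mat_adjoint A * A = 1\<^sub>m (dim_row A)"

definition SL :: "nat \<Rightarrow> complex mat set" where
  "SL n = {A \<in> carrier_mat n n. det A = 1}"

definition SU :: "nat \<Rightarrow> complex mat set" where
  "SU n = {A \<in> SL n. unitary_mat A}"

definition frob_norm_sq :: "complex mat \<Rightarrow> real" where
  "frob_norm_sq A = Re (sum_list (diag_mat (A * mat_adjoint A)))"

definition tuple_norm :: "nat \<Rightarrow> (nat \<Rightarrow> complex mat) \<Rightarrow> real" where
  "tuple_norm N U = sqrt (\<Sum>k=1..N. frob_norm_sq (U k))"

(* U a * U (a+1) * ... * U (b-1), in this order; the identity if b \<le> a. *)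
definition seg_prod :: "nat \<Rightarrow> (nat \<Rightarrow> complex mat) \<Rightarrow> nat \<Rightarrow> nat \<Rightarrow> complex mat" where
  "seg_prod n U a b = foldr (*) (map U [a..<b]) (1\<^sub>m n)"

(* Entrywise real power of a diagonal matrix with positive real diagonal entries. *)
definition diag_powr :: "complex mat \<Rightarrow> real \<Rightarrow> complex mat" where
  "diag_powr D a = mat_diag (dim_row D) (\<lambda>i. complex_of_real (Re (D $$ (i,i)) powr a))"

definition V_block ::
  "nat \<Rightarrow> nat \<Rightarrow> (nat \<Rightarrow> complex mat) \<Rightarrow> complex mat \<Rightarrow> complex mat \<Rightarrow> (nat \<Rightarrow> complex mat)
     \<Rightarrow> nat \<Rightarrow> complex mat" where
  "V_block n N U Q L P k =
     (if k < N
      then seg_prod n U k N * Q * diag_powr (L * mat_adjoint L) (- (real (N - k) / (2 * real N))) * P k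
      else Q * P k)"

definition V_mat ::
  "nat \<Rightarrow> nat \<Rightarrow> (nat \<Rightarrow> complex mat) \<Rightarrow> complex mat \<Rightarrow> complex mat \<Rightarrow> (nat \<Rightarrow> complex mat)
     \<Rightarrow> complex mat" where
  "V_mat n N U Q L P = diag_block_mat (map (V_block n N U Q L P) [1..<Suc N])"

definition T_mat :: "nat \<Rightarrow> nat \<Rightarrow> (nat \<Rightarrow> complex mat) \<Rightarrow> complex mat \<Rightarrow> complex mat" where
  "T_mat n N U Q = diag_block_mat (map (\<lambda>k. seg_prod n U k N * Q) [1..<Suc N])"

(* Entry (i,j) lies in block row i div n + 1 and block column j div n + 1; the block in
   block row k and block column l is R l to the power -(N-k), up to the factor 1/sqrt N. *)
definition S_mat :: "nat \<Rightarrow> nat \<Rightarrow> (nat \<Rightarrow> complex mat) \<Rightarrow> complex mat" where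
  "S_mat n N R = complex_of_real (1 / sqrt (real N)) \<cdot>\<^sub>m
     mat (n * N) (n * N) (\<lambda>(i,j).
       (mat_inv (R (j div n + 1)) ^\<^sub>m (N - (i div n + 1))) $$ (i mod n, j mod n))"

definition U_tilde ::
  "nat \<Rightarrow> (nat \<Rightarrow> complex mat) \<Rightarrow> (nat \<Rightarrow> complex mat) \<Rightarrow> nat \<Rightarrow> complex mat" where
  "U_tilde N U V k = mat_inv (V k) * U k * V (if k = N then 1 else Suc k)"

end

theory Submission
  imports Defs
begin

text \<open>
  Write T_k = U_k ... U_{N-1} Q and let D_k be the diagonal matrix with entries r_j^(N-k), where
  r_j = |\<mu>_j|^(1/N).  Then V_k = T_k D_k^{-1} P_k, so V^{-1} T is block diagonal with blocks
  P_k^* D_k.  The matrix diag(D_k) S is a direct sum over j of N by N matrices whose entries are powers of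
  the numbers r_j / \<nu>_j, divided by sqrt N; these numbers have modulus 1 and their d-th powers sum to zero
  for 0 < d < N, so the direct sum is unitary.
  For the norm, U_k T_{k+1} = T_k for k < N and U_N T_1 = T_N \<Lambda>, so V_k^{-1} U_k V_{k+1} is, up to
  unitary factors on both sides, a diagonal matrix whose entries have moduli r_j.
\<close>

subsection \<open>Adjoints and unitary matrices\<close>

lemma mat_adjoint_carrier:
  "A \<in> carrier_mat nr nc \<Longrightarrow> mat_adjoint A \<in> carrier_mat nc nr" for A :: "complex mat"
  by (auto simp: mat_adjoint_def mat_of_rows_def)

lemma mat_adjoint_index:
  fixes A :: "complex mat"
  assumes "i < dim_col A" "j < dim_row A"
  shows "mat_adjoint A $$ (i,j) = cnj (A $$ (j,i))"
  using assms by (simp add: mat_adjoint_def mat_of_rows_def)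

lemma mat_adjoint_mult:
  fixes A B :: "complex mat"
  assumes A: "A \<in> carrier_mat nr k" and B: "B \<in> carrier_mat k nc"
  shows "mat_adjoint (A * B) = mat_adjoint B * mat_adjoint A"
proof (rule eq_matI)
  have AB: "A * B \<in> carrier_mat nr nc" using A B by simp
  note c = mat_adjoint_carrier[OF A] mat_adjoint_carrier[OF B] mat_adjoint_carrier[OF AB]
  show "dim_row (mat_adjoint (A * B)) = dim_row (mat_adjoint B * mat_adjoint A)"
    "dim_col (mat_adjoint (A * B)) = dim_col (mat_adjoint B * mat_adjoint A)"
    using c by auto
  fix i j
  assume "i < dim_row (mat_adjoint B * mat_adjoint A)" "j < dim_col (mat_adjoint B * mat_adjoint A)"
  then have i: "i < nc" and j: "j < nr" using c by auto
  show "mat_adjoint (A * B) $$ (i,j) = (mat_adjoint B * mat_adjoint A) $$ (i,j)"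
    using c i j A B by (simp add: mat_adjoint_index scalar_prod_def mult.commute)
qed

lemma mat_adjoint_adjoint: "mat_adjoint (mat_adjoint A) = A" for A :: "complex mat"
proof -
  have c: "A \<in> carrier_mat (dim_row A) (dim_col A)" by simp
  note c' = mat_adjoint_carrier[OF c] mat_adjoint_carrier[OF mat_adjoint_carrier[OF c]]
  show ?thesis
    by (rule eq_matI) (use c' in \<open>auto simp: mat_adjoint_index\<close>)
qed

text \<open>For square matrices a right inverse is also a left inverse, so half of the definition of
  unitarity suffices.\<close>

lemma unitary_matI:
  assumes A: "A \<in> carrier_mat n n" and "A * mat_adjoint A = 1\<^sub>m n"
  shows "unitary_mat A"
  unfolding unitary_mat_def
  using assms mat_mult_left_right_inverse[OF A mat_adjoint_carrier[OF A]] by auto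

lemma unitary_matD:
  assumes "unitary_mat A" "A \<in> carrier_mat n n"
  shows "A * mat_adjoint A = 1\<^sub>m n" "mat_adjoint A * A = 1\<^sub>m n"
  using assms unfolding unitary_mat_def by auto

text \<open>Brings the two inner factors together; every cancellation of the form
  \<open>W * mat_adjoint W\<close> or \<open>mat_inv (T k) * T k\<close> below goes through this
  regrouping.\<close>

lemma mult_mat_assoc4:
  assumes "A \<in> carrier_mat n n" "B \<in> carrier_mat n n" "C \<in> carrier_mat n n" "D \<in> carrier_mat n n"
  shows "(A * B) * (C * D) = A * (B * C) * D"
  using assms by (simp add: assoc_mult_mat[of _ n n _ n _ n])

lemma unitary_mat_mult:
  assumes "unitary_mat A" "A \<in> carrier_mat n n" "unitary_mat B" "B \<in> carrier_mat n n"
  shows "unitary_mat (A * B)"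
proof (rule unitary_matI)
  show "A * B \<in> carrier_mat n n" using assms by simp
  show "A * B * mat_adjoint (A * B) = 1\<^sub>m n"
    using assms mult_mat_assoc4[of A n B "mat_adjoint B" "mat_adjoint A"]
    by (simp add: mat_adjoint_mult mat_adjoint_carrier unitary_matD)
qed

lemma unitary_mat_adjoint:
  assumes "unitary_mat A" "A \<in> carrier_mat n n"
  shows "unitary_mat (mat_adjoint A)"
  using assms unitary_matI[of "mat_adjoint A" n]
  by (simp add: mat_adjoint_adjoint mat_adjoint_carrier unitary_matD)

subsection \<open>The Frobenius norm\<close>

lemma frob_norm_sq_eq:
  assumes A: "A \<in> carrier_mat nr nc"
  shows "frob_norm_sq A = (\<Sum>i<nr. \<Sum>j<nc. (cmod (A $$ (i,j)))\<^sup>2)"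
proof -
  note Aa = mat_adjoint_carrier[OF A]
  have "sum_list (diag_mat (A * mat_adjoint A)) = (\<Sum>i<nr. (A * mat_adjoint A) $$ (i,i))"
    using A by (simp add: diag_mat_def sum_list_sum_nth atLeast0LessThan)
  also have "\<dots> = (\<Sum>i<nr. \<Sum>j<nc. A $$ (i,j) * cnj (A $$ (i,j)))"
    using A Aa by (intro sum.cong) (auto simp: scalar_prod_def mat_adjoint_index atLeast0LessThan)
  finally show ?thesis
    by (simp add: frob_norm_sq_def complex_mult_cnj cmod_def)
qed

lemma frob_norm_sq_adjoint: "frob_norm_sq (mat_adjoint A) = frob_norm_sq A"
proof -
  have A: "A \<in> carrier_mat (dim_row A) (dim_col A)" by simp
  show ?thesis
    unfolding frob_norm_sq_eq[OF A] frob_norm_sq_eq[OF mat_adjoint_carrier[OF A]]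
    by (subst sum.swap) (simp add: mat_adjoint_index)
qed

text \<open>The unitary factor cancels inside \<open>A * W * mat_adjoint (A * W)\<close>, so even
  the matrix under the trace is unchanged.\<close>

lemma frob_norm_sq_mult_unitary_right:
  assumes A: "A \<in> carrier_mat n n" and W: "W \<in> carrier_mat n n" "unitary_mat W"
  shows "frob_norm_sq (A * W) = frob_norm_sq A"
proof -
  have "A * W * mat_adjoint (A * W) = A * mat_adjoint A"
    using assms mult_mat_assoc4[of A n W "mat_adjoint W" "mat_adjoint A"]
    by (simp add: mat_adjoint_mult mat_adjoint_carrier unitary_matD)
  then show ?thesis by (simp add: frob_norm_sq_def)
qed

text \<open>Taking adjoints preserves the norm and moves \<open>W\<close> to the right-hand side,
  which replaces an appeal to cyclicity of the trace.\<close>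

lemma frob_norm_sq_mult_unitary_left:
  assumes A: "A \<in> carrier_mat n n" and W: "W \<in> carrier_mat n n" "unitary_mat W"
  shows "frob_norm_sq (W * A) = frob_norm_sq A"
  using frob_norm_sq_mult_unitary_right[OF mat_adjoint_carrier[OF A] mat_adjoint_carrier[OF W(1)]
      unitary_mat_adjoint[OF W(2,1)]] frob_norm_sq_adjoint[of "W * A"] frob_norm_sq_adjoint[of A]
  by (simp add: mat_adjoint_mult[OF W(1) A])

lemma frob_norm_sq_mat_diag: "frob_norm_sq (mat_diag n d) = (\<Sum>i<n. (cmod (d i))\<^sup>2)"
proof -
  have "frob_norm_sq (mat_diag n d) = (\<Sum>i<n. \<Sum>j<n. if i = j then (cmod (d i))\<^sup>2 else 0)"
    unfolding frob_norm_sq_eq[OF mat_diag_dim]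
    by (intro sum.cong) (auto simp: mat_diag_def)
  then show ?thesis by simp
qed

subsection \<open>Inverses, powers and segment products\<close>

text \<open>Lets an inverse be computed by exhibiting a one-sided candidate, so that the elimination
  procedure behind \<open>mat_inverse\<close> never has to be unfolded.\<close>

lemma mat_inv_eqI:
  assumes A: "A \<in> carrier_mat n n" and B: "B \<in> carrier_mat n n" and BA: "B * A = 1\<^sub>m n"
  shows "mat_inv A = B"
proof -
  have AB: "A * B = 1\<^sub>m n" using mat_mult_left_right_inverse[OF B A BA] .
  have "mat_inverse A \<noteq> None"
    \<comment> \<open>The value \<open>undefined\<close> only fills the extension slot of the ring
      record; being a unit does not depend on it.\<close>
    using mat_inverse(1)[OF A, of undefined] A B AB BA by (auto simp: Units_def ring_mat_def)
  then obtain C where C: "mat_inverse A = Some C" by auto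
  from mat_inverse(2)[OF A C] have C': "A * C = 1\<^sub>m n" "C \<in> carrier_mat n n" by auto
  have "C = B * A * C" using C' BA by simp
  also have "\<dots> = B" using A B C' by (simp add: assoc_mult_mat[of _ n n _ n _ n])
  finally show ?thesis by (simp add: mat_inv_def C)
qed

lemma mat_inv_det:
  assumes A: "A \<in> carrier_mat n n" and "det A \<noteq> 0"
  shows "mat_inv A \<in> carrier_mat n n" "mat_inv A * A = 1\<^sub>m n" "A * mat_inv A = 1\<^sub>m n"
proof -
  obtain B where "B \<in> carrier_mat n n" "B * A = 1\<^sub>m n" "A * B = 1\<^sub>m n"
    using det_non_zero_imp_unit[OF assms, of undefined] by (auto simp: Units_def ring_mat_def)
  then show "mat_inv A \<in> carrier_mat n n" "mat_inv A * A = 1\<^sub>m n" "A * mat_inv A = 1\<^sub>m n"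
    using mat_inv_eqI[OF A] by auto
qed

lemma det_mat_diag: "det (mat_diag n d) = (\<Prod>i<n. d i)" for d :: "nat \<Rightarrow> complex"
proof -
  have "det (mat_diag n d) = prod_list (diag_mat (mat_diag n d))"
    by (rule det_upper_triangular[of _ n]) (auto simp: mat_diag_def upper_triangular_def)
  also have "\<dots> = (\<Prod>i<n. d i)"
    by (auto simp: prod_list_diag_prod mat_diag_def atLeast0LessThan intro!: prod.cong)
  finally show ?thesis .
qed

lemma mat_diag_cong: "(\<And>i. i < n \<Longrightarrow> f i = g i) \<Longrightarrow> mat_diag n f = mat_diag n g"
  by (auto simp: mat_diag_def)

lemma mat_inv_mat_diag:
  assumes "\<And>i. i < n \<Longrightarrow> d i \<noteq> 0"
  shows "mat_inv (mat_diag n d) = mat_diag n (\<lambda>i. inverse (d i))"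
proof (rule mat_inv_eqI)
  have "mat_diag n (\<lambda>i. inverse (d i) * d i) = mat_diag n (\<lambda>_. 1)"
    using assms by (intro mat_diag_cong) auto
  then show "mat_diag n (\<lambda>i. inverse (d i)) * mat_diag n d = 1\<^sub>m n" by simp
qed auto

lemma mat_diag_pow: "mat_diag n d ^\<^sub>m m = mat_diag n (\<lambda>i. d i ^ m)" for d :: "nat \<Rightarrow> complex"
proof (induction m)
  case 0
  then show ?case by (simp add: carrier_matD(1)[OF mat_diag_dim])
next
  case (Suc m)
  then show ?case by (simp add: mult.commute)
qed

text \<open>The diagonal entries of the product are the squared moduli of the \<open>d i\<close>;
  they are real, so the \<open>Re\<close> in \<open>diag_powr\<close> loses nothing.\<close>

lemma diag_powr_mult_adjoint:
  "diag_powr (mat_diag n d * mat_adjoint (mat_diag n d)) a =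
     mat_diag n (\<lambda>i. complex_of_real ((cmod (d i))\<^sup>2 powr a))"
proof -
  have "mat_adjoint (mat_diag n d) = mat_diag n (\<lambda>i. cnj (d i))"
    using mat_adjoint_carrier[OF mat_diag_dim[of n d]]
    by (intro eq_matI) (auto simp: mat_adjoint_index mat_diag_def)
  then have "mat_diag n d * mat_adjoint (mat_diag n d) = mat_diag n (\<lambda>i. complex_of_real ((cmod (d i))\<^sup>2))"
    by (simp add: complex_norm_square del: of_real_power)
  then show ?thesis
    by (auto simp: diag_powr_def mat_diag_def simp del: of_real_power)
qed

lemma seg_prod_Cons: "a < b \<Longrightarrow> seg_prod n U a b = U a * seg_prod n U (Suc a) b"
  by (simp add: seg_prod_def upt_rec)

lemma seg_prod_self: "seg_prod n U a a = 1\<^sub>m n"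
  by (simp add: seg_prod_def)

lemma seg_prod_SL:
  assumes "\<And>k. k \<in> {a..<b} \<Longrightarrow> U k \<in> SL n"
  shows "seg_prod n U a b \<in> SL n"
proof (cases "a \<le> b")
  case True
  then show ?thesis using assms
  \<comment> \<open>Downward induction on the left end, because the product unfolds there; the empty
    segment is the identity.\<close>
  proof (induction a rule: inc_induct)
    case base
    then show ?case by (simp add: seg_prod_self SL_def)
  next
    case (step a)
    then have "U a \<in> SL n" "seg_prod n U (Suc a) b \<in> SL n" by auto
    then show ?case
      using step.hyps mult_carrier_mat[of "U a" n n] by (auto simp: seg_prod_Cons SL_def det_mult[of _ n])
  qed
next
  case False
  then show ?thesis by (simp add: seg_prod_def SL_def)
qed

subsection \<open>Block matrices with square blocks of equal size\<close>

text \<open>Passes between entry indices and block numbers. Positivity of \<open>n\<close> excludes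
  the convention \<open>i div 0 = 0\<close>.\<close>

lemma block_index_less: "i div n < N \<longleftrightarrow> i < n * N" if "n > 0" for i :: nat
  using that by (simp add: div_less_iff_less_mult mult.commute)

text \<open>The common shape of \<open>V_mat\<close> and \<open>T_mat\<close>, with blocks numbered
  from 1, so that both can be calculated with blockwise.\<close>

definition block_diag :: "nat \<Rightarrow> (nat \<Rightarrow> 'a::zero mat) \<Rightarrow> 'a mat" where
  "block_diag N f = diag_block_mat (map f [1..<Suc N])"

text \<open>The list of blocks grows at its right end, so the last block is the one to split off in
  inductions on \<open>N\<close>.\<close>

lemma block_diag_Suc:
  "block_diag (Suc N) f = four_block_mat (block_diag N f)
     (0\<^sub>m (dim_row (block_diag N f)) (dim_col (f (Suc N))))
     (0\<^sub>m (dim_row (f (Suc N))) (dim_col (block_diag N f))) (f (Suc N))"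
  by (simp add: block_diag_def diag_block_mat_last Let_def)

lemma block_diag_cong: "(\<And>k. k \<in> {1..N} \<Longrightarrow> f k = g k) \<Longrightarrow> block_diag N f = block_diag N g"
  unfolding block_diag_def by (intro arg_cong[of _ _ diag_block_mat] map_cong) auto

lemma block_diag_carrier:
  assumes "\<And>k. k \<in> {1..N} \<Longrightarrow> f k \<in> carrier_mat n n"
  shows "block_diag N f \<in> carrier_mat (n * N) (n * N)"
  using assms
proof (induction N)
  case 0
  then show ?case by (simp add: block_diag_def)
next
  case (Suc N)
  have "block_diag N f \<in> carrier_mat (n * N) (n * N)" "f (Suc N) \<in> carrier_mat n n"
    using Suc by auto
  from four_block_carrier_mat[OF this] show ?case by (simp add: block_diag_Suc add.commute)
qed

text \<open>Entries count from 0 and blocks from 1, whence the \<open>Suc\<close> in the block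
  number. The induction adds the last block and distinguishes whether each index falls into
  it.\<close>

lemma block_diag_index:
  assumes f: "\<And>k. k \<in> {1..N} \<Longrightarrow> f k \<in> carrier_mat n n" and ij: "i < n * N" "j < n * N"
  shows "block_diag N f $$ (i,j) =
    (if i div n = j div n then f (Suc (i div n)) $$ (i mod n, j mod n) else 0)"
  using assms
proof (induction N)
  case 0
  then show ?case by simp
next
  case (Suc N)
  then have n: "n > 0" by (cases n) auto
  have c: "block_diag N f \<in> carrier_mat (n * N) (n * N)" "f (Suc N) \<in> carrier_mat n n"
    using Suc by (auto intro!: block_diag_carrier)
  then have fc: "dim_row (f (Suc N)) = n" "dim_col (f (Suc N)) = n" by auto
  \<comment> \<open>An index past the first \<open>N\<close> blocks has quotient exactly
    \<open>N\<close>, so its offset in the last block is its remainder.\<close>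
  have split: "m div n = N \<and> m mod n = m - n * N" if "\<not> m < n * N" "m < n * Suc N" for m
  proof -
    have "m div n < Suc N" "\<not> m div n < N" using that block_index_less[OF n] by blast+
    then have "m div n = N" by simp
    then show ?thesis using minus_mult_div_eq_mod[of m n] by simp
  qed
  show ?case
  proof (cases "i < n * N"; cases "j < n * N")
    assume "i < n * N" "j < n * N"
    then show ?thesis using c Suc by (simp add: block_diag_Suc)
  next
    assume *: "i < n * N" "\<not> j < n * N"
    then have "i div n < N" using block_index_less[OF n] by blast
    then show ?thesis using * c fc Suc.prems split[of j] by (simp add: block_diag_Suc)
  next
    assume *: "\<not> i < n * N" "j < n * N"
    then have "j div n < N" using block_index_less[OF n] by blast
    then show ?thesis using * c fc Suc.prems split[of i] by (simp add: block_diag_Suc)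
  next
    assume "\<not> i < n * N" "\<not> j < n * N"
    then show ?thesis using c fc Suc.prems split[of i] split[of j] by (simp add: block_diag_Suc)
  qed
qed

lemma block_diag_mult:
  fixes f g :: "nat \<Rightarrow> 'a::comm_ring_1 mat"
  assumes "\<And>k. k \<in> {1..N} \<Longrightarrow> f k \<in> carrier_mat n n" "\<And>k. k \<in> {1..N} \<Longrightarrow> g k \<in> carrier_mat n n"
  shows "block_diag N f * block_diag N g = block_diag N (\<lambda>k. f k * g k)"
  using assms
proof (induction N)
  case 0
  then show ?case by (auto simp: block_diag_def)
next
  case (Suc N)
  have c: "block_diag N f \<in> carrier_mat (n * N) (n * N)" "f (Suc N) \<in> carrier_mat n n"
    "block_diag N g \<in> carrier_mat (n * N) (n * N)" "g (Suc N) \<in> carrier_mat n n"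
    "block_diag N f * block_diag N g \<in> carrier_mat (n * N) (n * N)"
    "f (Suc N) * g (Suc N) \<in> carrier_mat n n"
    using Suc.prems by (auto intro!: block_diag_carrier mult_carrier_mat)
  have IH: "block_diag N f * block_diag N g = block_diag N (\<lambda>k. f k * g k)"
    using Suc by simp
  have "block_diag (Suc N) f * block_diag (Suc N) g = four_block_mat
    (block_diag N f * block_diag N g) (0\<^sub>m (n * N) n) (0\<^sub>m n (n * N)) (f (Suc N) * g (Suc N))"
    unfolding block_diag_Suc using c
    by (subst mult_four_block_mat[of _ "n * N" "n * N" _ n _ n _ _ "n * N" _ n]) auto
  also have "\<dots> = block_diag (Suc N) (\<lambda>k. f k * g k)"
    unfolding block_diag_Suc IH[symmetric] using c by simp
  finally show ?case .
qed

lemma block_diag_one: "block_diag N (\<lambda>k. 1\<^sub>m n) = 1\<^sub>m (n * N)"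
proof (rule eq_matI)
  have c: "block_diag N (\<lambda>k. 1\<^sub>m n :: 'a mat) \<in> carrier_mat (n * N) (n * N)"
    by (rule block_diag_carrier) simp
  then show "dim_row (block_diag N (\<lambda>k. 1\<^sub>m n :: 'a mat)) = dim_row (1\<^sub>m (n * N) :: 'a mat)"
    "dim_col (block_diag N (\<lambda>k. 1\<^sub>m n :: 'a mat)) = dim_col (1\<^sub>m (n * N) :: 'a mat)" by auto
  fix i j assume "i < dim_row (1\<^sub>m (n * N) :: 'a mat)" "j < dim_col (1\<^sub>m (n * N) :: 'a mat)"
  then have ij: "i < n * N" "j < n * N" by auto
  then have n: "n > 0" by (cases n) auto
  have "i = j \<longleftrightarrow> i div n = j div n \<and> i mod n = j mod n"
    by (metis div_mult_mod_eq)
  then show "block_diag N (\<lambda>k. 1\<^sub>m n :: 'a mat) $$ (i,j) = 1\<^sub>m (n * N) $$ (i,j)"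
    using ij n by (subst block_diag_index[where n=n]) auto
qed

lemma block_diag_adjoint:
  fixes f :: "nat \<Rightarrow> complex mat"
  assumes f: "\<And>k. k \<in> {1..N} \<Longrightarrow> f k \<in> carrier_mat n n"
  shows "mat_adjoint (block_diag N f) = block_diag N (\<lambda>k. mat_adjoint (f k))"
proof (rule eq_matI)
  have f': "\<And>k. k \<in> {1..N} \<Longrightarrow> mat_adjoint (f k) \<in> carrier_mat n n"
    using f mat_adjoint_carrier by blast
  have c: "block_diag N f \<in> carrier_mat (n * N) (n * N)"
    "mat_adjoint (block_diag N f) \<in> carrier_mat (n * N) (n * N)"
    "block_diag N (\<lambda>k. mat_adjoint (f k)) \<in> carrier_mat (n * N) (n * N)"
    using f f' by (auto intro!: block_diag_carrier mat_adjoint_carrier)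
  then show "dim_row (mat_adjoint (block_diag N f)) = dim_row (block_diag N (\<lambda>k. mat_adjoint (f k)))"
    "dim_col (mat_adjoint (block_diag N f)) = dim_col (block_diag N (\<lambda>k. mat_adjoint (f k)))"
    by auto
  fix i j
  assume "i < dim_row (block_diag N (\<lambda>k. mat_adjoint (f k)))"
    "j < dim_col (block_diag N (\<lambda>k. mat_adjoint (f k)))"
  then have ij: "i < n * N" "j < n * N" using c by auto
  then have n: "n > 0" by (cases n) auto
  have "i div n < N" using ij block_index_less[OF n] by blast
  then have fi: "f (Suc (i div n)) \<in> carrier_mat n n" using f by auto
  have "mat_adjoint (block_diag N f) $$ (i,j) = cnj (block_diag N f $$ (j,i))"
    using ij c by (intro mat_adjoint_index) auto
  also have "block_diag N f $$ (j,i) =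
      (if j div n = i div n then f (Suc (j div n)) $$ (j mod n, i mod n) else 0)"
    using f ij(2,1) by (rule block_diag_index)
  also have "cnj \<dots> =
      (if i div n = j div n then mat_adjoint (f (Suc (i div n))) $$ (i mod n, j mod n) else 0)"
    using fi n by (auto simp: mat_adjoint_index)
  also have "\<dots> = block_diag N (\<lambda>k. mat_adjoint (f k)) $$ (i,j)"
    using f' ij by (rule block_diag_index[symmetric])
  finally show "mat_adjoint (block_diag N f) $$ (i,j) = block_diag N (\<lambda>k. mat_adjoint (f k)) $$ (i,j)" .
qed

lemma block_diag_unitary:
  assumes f: "\<And>k. k \<in> {1..N} \<Longrightarrow> f k \<in> carrier_mat n n"
    and u: "\<And>k. k \<in> {1..N} \<Longrightarrow> unitary_mat (f k)"
  shows "unitary_mat (block_diag N f)"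
proof (rule unitary_matI[OF block_diag_carrier[OF f]])
  have "block_diag N f * mat_adjoint (block_diag N f) = block_diag N (\<lambda>k. f k * mat_adjoint (f k))"
    by (subst block_diag_adjoint[where n=n]) (auto intro!: block_diag_mult[where n=n] f mat_adjoint_carrier)
  also have "\<dots> = block_diag N (\<lambda>k. 1\<^sub>m n)"
    using f u by (intro block_diag_cong) (simp add: unitary_matD)
  finally show "block_diag N f * mat_adjoint (block_diag N f) = 1\<^sub>m (n * N)"
    by (simp add: block_diag_one)
qed simp_all

text \<open>Used to see left multiplication by such a block matrix as a scaling of single
  rows.\<close>

lemma block_diag_mat_diag:
  "block_diag N (\<lambda>k. mat_diag n (d k)) = mat_diag (n * N) (\<lambda>i. d (Suc (i div n)) (i mod n))"
proof (rule eq_matI)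
  let ?D = "mat_diag (n * N) (\<lambda>i. d (Suc (i div n)) (i mod n))"
  have c: "block_diag N (\<lambda>k. mat_diag n (d k)) \<in> carrier_mat (n * N) (n * N)"
    by (rule block_diag_carrier) simp
  then show "dim_row (block_diag N (\<lambda>k. mat_diag n (d k))) = dim_row ?D"
    "dim_col (block_diag N (\<lambda>k. mat_diag n (d k))) = dim_col ?D" by (auto simp: mat_diag_def)
  fix i j assume "i < dim_row ?D" "j < dim_col ?D"
  then have ij: "i < n * N" "j < n * N" by (auto simp: mat_diag_def)
  then have n: "n > 0" by (cases n) auto
  have "i = j \<longleftrightarrow> i div n = j div n \<and> i mod n = j mod n"
    by (metis div_mult_mod_eq)
  then show "block_diag N (\<lambda>k. mat_diag n (d k)) $$ (i,j) = ?D $$ (i,j)"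
    using ij n by (subst block_diag_index[where n=n]) (auto simp: mat_diag_def)
qed

lemma sum_blocks:
  fixes g :: "nat \<Rightarrow> 'a::comm_monoid_add"
  shows "(\<Sum>j<n * N. g j) = (\<Sum>l=1..N. \<Sum>m<n. g ((l - 1) * n + m))"
proof -
  have "(\<Sum>j<n * N. g j) = (\<Sum>l<N. sum g {l * n..<l * n + n})"
    by (simp add: sum.nat_group mult.commute)
  also have "\<dots> = (\<Sum>l<N. \<Sum>m<n. g (l * n + m))"
    by (intro sum.cong[OF refl]) (simp add: sum.atLeastLessThan_shift_0 atLeast0LessThan)
  also have "\<dots> = (\<Sum>l=1..N. \<Sum>m<n. g ((l - 1) * n + m))"
    by (rule sum.reindex_bij_witness[of _ "\<lambda>l. l - 1" Suc]) auto
  finally show ?thesis .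
qed

subsection \<open>Sums of powers of roots and the Fourier matrix\<close>

text \<open>Multiplication by a primitive \<open>N\<close>th root of unity \<open>\<zeta>\<close>
  permutes the roots of \<open>z ^ N = c\<close>, so the sum equals \<open>\<zeta> ^ d\<close> times
  itself, while \<open>\<zeta> ^ d\<close> differs from 1.\<close>

lemma sum_nth_roots_power:
  fixes c :: complex
  assumes d: "0 < d" "d < N"
  shows "(\<Sum>z | z ^ N = c. z ^ d) = 0"
proof -
  define \<zeta> where "\<zeta> = cis (2 * pi / real N)"
  have N: "N > 0" using d by simp
  have z1: "\<zeta> ^ N = 1" using N by (simp add: \<zeta>_def DeMoivre)
  have z0: "\<zeta> \<noteq> 0" by (simp add: \<zeta>_def)
  have zd: "\<zeta> ^ d \<noteq> 1"
  proof
    assume "\<zeta> ^ d = 1"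
    then have eq: "cis (2 * pi * real d / real N) = cis (2 * pi * real 0 / real N)"
      by (simp add: \<zeta>_def DeMoivre mult_ac)
    \<comment> \<open>The angles with numerators \<open>d\<close> and 0 would give the same root of
      unity, but distinct numerators below \<open>N\<close> give distinct roots.\<close>
    show False
      using inj_onD[OF bij_betw_imp_inj_on[OF bij_betw_roots_unity[OF N]] eq] d by simp
  qed
  have "(\<Sum>z | z ^ N = c. z ^ d) = (\<Sum>z | z ^ N = c. (\<zeta> * z) ^ d)"
    by (rule sum.reindex_bij_witness[of _ "\<lambda>z. \<zeta> * z" "\<lambda>z. z / \<zeta>"])
      (use z0 z1 in \<open>auto simp: power_mult_distrib power_divide\<close>)
  also have "\<dots> = \<zeta> ^ d * (\<Sum>z | z ^ N = c. z ^ d)"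
    by (simp add: power_mult_distrib sum_distrib_left)
  finally have "(\<Sum>z | z ^ N = c. z ^ d) = \<zeta> ^ d * (\<Sum>z | z ^ N = c. z ^ d)" .
  then show ?thesis using zd by simp
qed

text \<open>On the unit circle conjugation is inversion, so each summand is a power of
  \<open>w l\<close>, or the conjugate of one, with exponent the distance of \<open>a\<close> and
  \<open>b\<close>. If that distance is positive, it is below \<open>N\<close> and
  \<open>zero\<close> applies.\<close>

lemma sum_unit_powers:
  fixes w :: "'b \<Rightarrow> complex"
  assumes unit: "\<And>l. l \<in> A \<Longrightarrow> cmod (w l) = 1"
    and zero: "\<And>d. 0 < d \<Longrightarrow> d < N \<Longrightarrow> (\<Sum>l\<in>A. w l ^ d) = 0"
    and "a < N" "b < N"
  shows "(\<Sum>l\<in>A. w l ^ a * cnj (w l ^ b)) = (if a = b then of_nat (card A) else 0)"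
proof -
  have u: "w l ^ k * cnj (w l ^ k) = 1" if "l \<in> A" for l k
    using unit[OF that] by (simp add: complex_norm_square[symmetric] norm_power del: complex_cnj_power)
  consider "a = b" | "a > b" | "a < b" by linarith
  then show ?thesis
  proof cases
    case 1
    then show ?thesis using u by simp
  next
    case 2
    have "w l ^ a * cnj (w l ^ b) = w l ^ (a - b)" if "l \<in> A" for l
    proof -
      have "w l ^ a = w l ^ (a - b) * w l ^ b" using 2 by (simp flip: power_add)
      then show ?thesis using u[OF that, of b] by (simp add: mult.assoc)
    qed
    then show ?thesis using 2 zero[of "a - b"] assms by simp
  next
    case 3
    have "w l ^ a * cnj (w l ^ b) = cnj (w l ^ (b - a))" if "l \<in> A" for l
    proof -
      have "w l ^ b = w l ^ (b - a) * w l ^ a" using 3 by (simp flip: power_add)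
      then show ?thesis using u[OF that, of a] by (simp add: mult_ac)
    qed
    then have "(\<Sum>l\<in>A. w l ^ a * cnj (w l ^ b)) = cnj (\<Sum>l\<in>A. w l ^ (b - a))" by simp
    then show ?thesis using 3 zero[of "b - a"] assms by simp
  qed
qed

text \<open>Sorting rows and columns by their residue modulo \<open>n\<close> would give a direct
  sum of \<open>n\<close> matrices of Fourier type. Without permuting anything: rows with different
  residues have disjoint supports, and rows with equal residues are orthonormal by
  \<open>sum_unit_powers\<close>.\<close>

lemma unitary_fourier_blocks:
  fixes w :: "nat \<Rightarrow> nat \<Rightarrow> complex"
  assumes unit: "\<And>l m. l \<in> {1..N} \<Longrightarrow> m < n \<Longrightarrow> cmod (w l m) = 1"
    and zero: "\<And>m d. m < n \<Longrightarrow> 0 < d \<Longrightarrow> d < N \<Longrightarrow> (\<Sum>l=1..N. w l m ^ d) = 0"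
  shows "unitary_mat (mat (n * N) (n * N) (\<lambda>(i,j).
    if i mod n = j mod n then w (Suc (j div n)) (i mod n) ^ (N - Suc (i div n)) / sqrt (real N) else 0))"
    (is "unitary_mat ?F")
proof (rule unitary_matI)
  show F: "?F \<in> carrier_mat (n * N) (n * N)" by simp
  note Fa = mat_adjoint_carrier[OF F]
  show "?F * mat_adjoint ?F = 1\<^sub>m (n * N)"
  proof (rule eq_matI)
    show "dim_row (?F * mat_adjoint ?F) = dim_row (1\<^sub>m (n * N) :: complex mat)"
      "dim_col (?F * mat_adjoint ?F) = dim_col (1\<^sub>m (n * N) :: complex mat)" using Fa by auto
    fix i i' assume "i < dim_row (1\<^sub>m (n * N) :: complex mat)" "i' < dim_col (1\<^sub>m (n * N) :: complex mat)"
    then have i: "i < n * N" and i': "i' < n * N" by auto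
    then have n: "n > 0" and N: "N > 0" by (cases n; simp) (use i in \<open>cases N; simp\<close>)
    have id: "i div n < N" "i' div n < N" using i i' block_index_less[OF n] by blast+
    let ?a = "N - Suc (i div n)" and ?b = "N - Suc (i' div n)"
    let ?p = "i mod n" and ?q = "i' mod n"
    have sq: "complex_of_real (sqrt (real N)) * complex_of_real (sqrt (real N)) = of_nat N"
      by (simp flip: of_real_mult)
    have "(?F * mat_adjoint ?F) $$ (i,i') = (\<Sum>j<n * N. ?F $$ (i,j) * cnj (?F $$ (i',j)))"
      using i i' Fa by (simp add: scalar_prod_def mat_adjoint_index atLeast0LessThan)
    also have "\<dots> = (\<Sum>j<n * N. if ?p = j mod n \<and> ?q = j mod n
        then w (Suc (j div n)) ?p ^ ?a * cnj (w (Suc (j div n)) ?q ^ ?b) / of_nat N else 0)"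
      using i i' sq by (intro sum.cong) auto
    \<comment> \<open>A column is split into its block \<open>l\<close> and its residue
      \<open>m\<close>; only the residue shared with both rows contributes.\<close>
    also have "\<dots> = (\<Sum>l=1..N. \<Sum>m<n. if ?p = m \<and> ?q = m
        then w l ?p ^ ?a * cnj (w l ?q ^ ?b) / of_nat N else 0)"
      unfolding sum_blocks using n by (intro sum.cong) auto
    also have "\<dots> = (\<Sum>l=1..N. if ?p = ?q then w l ?p ^ ?a * cnj (w l ?p ^ ?b) / of_nat N else 0)"
    proof (intro sum.cong refl)
      fix l
      have "(\<Sum>m<n. if ?p = m \<and> ?q = m then w l ?p ^ ?a * cnj (w l ?q ^ ?b) / of_nat N else 0) =
        (\<Sum>m<n. if ?p = m then (if ?p = ?q then w l ?p ^ ?a * cnj (w l ?p ^ ?b) / of_nat N else 0) else 0)"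
        by (intro sum.cong) auto
      also have "\<dots> = (if ?p = ?q then w l ?p ^ ?a * cnj (w l ?p ^ ?b) / of_nat N else 0)"
        using n by (subst sum.delta') auto
      finally show "(\<Sum>m<n. if ?p = m \<and> ?q = m then w l ?p ^ ?a * cnj (w l ?q ^ ?b) / of_nat N else 0) =
        (if ?p = ?q then w l ?p ^ ?a * cnj (w l ?p ^ ?b) / of_nat N else 0)" .
    qed
    also have "\<dots> = (if ?p = ?q then (\<Sum>l=1..N. w l ?p ^ ?a * cnj (w l ?p ^ ?b)) / of_nat N else 0)"
      by (simp add: sum_divide_distrib)
    also have "\<dots> = (if ?p = ?q \<and> ?a = ?b then 1 else 0)"
      using n N unit zero by (subst sum_unit_powers[where N=N]) auto
    \<comment> \<open>Both block numbers are below \<open>N\<close>, so the subtractions are not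
      truncated and equal exponents force equal blocks.\<close>
    also have "?p = ?q \<and> ?a = ?b \<longleftrightarrow> i = i'"
      using id by (metis Suc_diff_Suc diff_Suc_Suc diff_diff_cancel div_mult_mod_eq less_imp_le)
    finally show "(?F * mat_adjoint ?F) $$ (i,i') = 1\<^sub>m (n * N) $$ (i,i')" using i i' by simp
  qed
qed

theorem theorem4:
  fixes n N :: nat
    and U P :: "nat \<Rightarrow> complex mat"
    and Q :: "complex mat"
    and \<mu> :: "nat \<Rightarrow> complex"
    and \<nu> :: "nat \<Rightarrow> nat \<Rightarrow> complex"
  assumes "n \<ge> 2" and "N \<ge> 1"
    and "\<And>k. k \<in> {1..N} \<Longrightarrow> U k \<in> SL n"
    and "Q \<in> SL n"
    and "U N * seg_prod n U 1 N = Q * mat_diag n \<mu> * mat_inv Q"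
    and "\<And>j. j < n \<Longrightarrow> bij_betw (\<lambda>k. \<nu> k j) {1..N} {z. z ^ N = \<mu> j}"
    and "\<And>k. k \<in> {1..N} \<Longrightarrow> P k \<in> SU n"
  shows "unitary_mat
           (mat_inv (V_mat n N U Q (mat_diag n \<mu>) P) * T_mat n N U Q *
            S_mat n N (\<lambda>k. mat_diag n (\<nu> k)))
       \<and> tuple_norm N (U_tilde N U (V_block n N U Q (mat_diag n \<mu>) P)) =
           sqrt (real N * (\<Sum>j<n. cmod (\<mu> j) powr (2 / real N)))"
proof -

  \<comment> \<open>Carrier facts, eigenvalues and the moduli of their roots\<close>
  note U = assms(3) and N = assms(2) and \<nu> = assms(6)
  have Q: "Q \<in> carrier_mat n n" "det Q = 1" using assms(4) by (auto simp: SL_def)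
  have Qi: "mat_inv Q \<in> carrier_mat n n" "mat_inv Q * Q = 1\<^sub>m n" "Q * mat_inv Q = 1\<^sub>m n"
    using mat_inv_det[OF Q(1)] Q(2) by auto
  have Uc: "U k \<in> carrier_mat n n" if "k \<in> {1..N}" for k using U[OF that] by (simp add: SL_def)
  have P: "P k \<in> carrier_mat n n" "unitary_mat (P k)" if "k \<in> {1..N}" for k
    using assms(7)[OF that] by (auto simp: SU_def SL_def)
  note Pa = mat_adjoint_carrier[OF P(1)]
  have seg: "seg_prod n U k N \<in> carrier_mat n n" "det (seg_prod n U k N) = 1" if "k \<in> {1..N}" for k
    using seg_prod_SL[of k N U n] U that by (auto simp: SL_def)

  \<comment> \<open>Comparing determinants: the left-hand side of the diagonalization has
    determinant 1 and the right-hand side has the product of the eigenvalues, so none of them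
    vanishes.\<close>
  have \<mu>: "\<mu> j \<noteq> 0" if "j < n" for j
  proof -
    have "det (U N * seg_prod n U 1 N) = 1"
      using U[of N] N seg[of 1] by (simp add: SL_def det_mult[of _ n])
    moreover have "det (Q * mat_diag n \<mu> * mat_inv Q) = det (Q * mat_inv Q) * det (mat_diag n \<mu>)"
      using Q Qi(1) by (simp add: det_mult[of _ n])
    ultimately have "(\<Prod>i<n. \<mu> i) = 1" using assms(5) Qi by (simp add: det_mat_diag)
    then show ?thesis using that by (metis finite_lessThan lessThan_iff prod_zero zero_neq_one)
  qed

  define r where "r i = cmod (\<mu> i) powr (1 / real N)" for i
  have r: "r i > 0" if "i < n" for i using \<mu>[OF that] by (simp add: r_def)
  have rN: "r i ^ N = cmod (\<mu> i)" if "i < n" for i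
    using \<mu>[OF that] N by (simp add: r_def powr_power)
  have \<nu>N: "\<nu> l i ^ N = \<mu> i" if "l \<in> {1..N}" "i < n" for l i
    using bij_betwE[OF \<nu>[OF that(2)]] that by auto
  have \<nu>r: "cmod (\<nu> l i) = r i" if "l \<in> {1..N}" "i < n" for l i
  proof -
    have "cmod (\<nu> l i) ^ N = r i ^ N" using \<nu>N[OF that] rN[OF that(2)] by (simp flip: norm_power)
    then show ?thesis using power_eq_imp_eq_base[of "cmod (\<nu> l i)" N "r i"] r[OF that(2)] N by simp
  qed

  \<comment> \<open>Factorization of the blocks \<open>V k\<close> and their inverses\<close>
  define T where "T k = seg_prod n U k N * Q" for k
  \<comment> \<open>\<open>E k\<close> will turn out to be the power of \<Lambda>\<Lambda>* in
    \<open>V k\<close>, and \<open>E' k\<close> is its inverse. Hence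
    \<open>V k = T k * G k\<close>, and \<open>H k\<close> inverts \<open>G k\<close>. For
    \<open>k = N\<close> the exponent is 0 and both diagonal matrices are the identity.\<close>
  define E where "E k = mat_diag n (\<lambda>i. complex_of_real (inverse (r i ^ (N - k))))" for k
  define E' where "E' k = mat_diag n (\<lambda>i. complex_of_real (r i ^ (N - k)))" for k
  define G where "G k = E k * P k" for k
  define H where "H k = mat_adjoint (P k) * E' k" for k
  define V where "V = V_block n N U Q (mat_diag n \<mu>) P"

  have T: "T k \<in> carrier_mat n n" "det (T k) = 1" if "k \<in> {1..N}" for k
    using seg[OF that] Q by (auto simp: T_def det_mult[of _ n])
  have Ti: "mat_inv (T k) \<in> carrier_mat n n" "mat_inv (T k) * T k = 1\<^sub>m n" if "k \<in> {1..N}" for k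
    using mat_inv_det[OF T(1)[OF that]] T(2)[OF that] by auto
  have E: "E k \<in> carrier_mat n n" "E' k \<in> carrier_mat n n" for k by (auto simp: E_def E'_def)
  have G: "G k \<in> carrier_mat n n" if "k \<in> {1..N}" for k unfolding G_def using E(1) P(1)[OF that] by (rule mult_carrier_mat)
  have H: "H k \<in> carrier_mat n n" if "k \<in> {1..N}" for k unfolding H_def using Pa[OF that] E(2) by (rule mult_carrier_mat)
  have EE: "E' k * E k = 1\<^sub>m n" for k
    unfolding E_def E'_def mat_diag_diag
    by (subst mat_diag_one[symmetric], intro mat_diag_cong) (use r in \<open>force simp flip: of_real_mult\<close>)
  have HG: "H k * G k = 1\<^sub>m n" if "k \<in> {1..N}" for k
    unfolding H_def G_def using mult_mat_assoc4[OF Pa[OF that] E(2) E(1) P(1)[OF that]]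
    by (simp add: EE right_mult_one_mat[OF Pa[OF that]] unitary_matD(2)[OF P(2,1)[OF that]])

  \<comment> \<open>The 2 in the denominator of the exponent undoes the squaring of the moduli. The
    case \<open>k = N\<close>, where \<open>V_block\<close> has no diagonal factor and the segment
    product is empty, fits the same formula.\<close>
  have VTG: "V k = T k * G k" if k: "k \<in> {1..N}" for k
  proof (cases "k < N")
    case True
    have "diag_powr (mat_diag n \<mu> * mat_adjoint (mat_diag n \<mu>)) (- (real (N - k) / (2 * real N))) = E k"
      unfolding diag_powr_mult_adjoint E_def
    proof (intro mat_diag_cong arg_cong[of _ _ complex_of_real])
      fix i assume i: "i < n"
      have "(cmod (\<mu> i))\<^sup>2 powr - (real (N - k) / (2 * real N)) =
          (cmod (\<mu> i) powr 2) powr - (real (N - k) / (2 * real N))"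
        using \<mu>[OF i] by (simp add: powr_numeral)
      also have "\<dots> = r i powr - real (N - k)"
        unfolding r_def powr_powr by simp
      also have "\<dots> = inverse (r i ^ (N - k))"
        using r[OF i] by (simp add: powr_minus powr_realpow)
      finally show "(cmod (\<mu> i))\<^sup>2 powr - (real (N - k) / (2 * real N)) = inverse (r i ^ (N - k))" .
    qed
    then show ?thesis
      using True T(1)[OF k] E(1)[of k] P(1)[OF k] by (simp add: V_def V_block_def T_def G_def)
  next
    case False
    then have "k = N" using k by auto
    then show ?thesis
      using Q(1) P(1)[OF k] by (simp add: V_def V_block_def T_def G_def E_def seg_prod_self)
  qed
  have V: "V k \<in> carrier_mat n n" if "k \<in> {1..N}" for k
    using VTG[OF that] T(1)[OF that] G[OF that] by simp
  have HTV: "(H k * mat_inv (T k)) * V k = 1\<^sub>m n" if "k \<in> {1..N}" for k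
    using mult_mat_assoc4[OF H[OF that] Ti(1)[OF that] T(1)[OF that] G[OF that]]
      right_mult_one_mat[OF H[OF that]]
    by (simp add: VTG[OF that] HG[OF that] Ti(2)[OF that])
  have HT: "H k * mat_inv (T k) \<in> carrier_mat n n" if "k \<in> {1..N}" for k
    using H[OF that] Ti(1)[OF that] by simp
  have HTT: "H k * mat_inv (T k) * T k = H k" if "k \<in> {1..N}" for k
    using assoc_mult_mat[OF H[OF that] Ti(1)[OF that] T(1)[OF that]] Ti(2)[OF that]
      right_mult_one_mat[OF H[OF that]] by simp

  \<comment> \<open>Unitarity of the product with \<open>S_mat\<close>\<close>
  have "mat_inv (block_diag N V) = block_diag N (\<lambda>k. H k * mat_inv (T k))"
  proof (rule mat_inv_eqI)
    have "block_diag N (\<lambda>k. H k * mat_inv (T k)) * block_diag N V =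
        block_diag N (\<lambda>k. H k * mat_inv (T k) * V k)"
      by (rule block_diag_mult[OF HT V])
    also have "\<dots> = block_diag N (\<lambda>k. 1\<^sub>m n)" using HTV by (rule block_diag_cong)
    finally show "block_diag N (\<lambda>k. H k * mat_inv (T k)) * block_diag N V = 1\<^sub>m (n * N)"
      by (simp add: block_diag_one)
  qed (intro block_diag_carrier V HT; assumption)+
  moreover have "V_mat n N U Q (mat_diag n \<mu>) P = block_diag N V"
    by (simp add: V_mat_def block_diag_def V_def)
  moreover have "T_mat n N U Q = block_diag N T"
    by (simp add: T_mat_def block_diag_def T_def[abs_def])
  moreover have "block_diag N (\<lambda>k. H k * mat_inv (T k)) * block_diag N T =
      block_diag N (\<lambda>k. H k * mat_inv (T k) * T k)"
    by (rule block_diag_mult[OF HT T(1)])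
  ultimately have "mat_inv (V_mat n N U Q (mat_diag n \<mu>) P) * T_mat n N U Q =
      block_diag N (\<lambda>k. H k * mat_inv (T k) * T k)"
    by simp
  \<comment> \<open>The factor \<open>T k\<close> in \<open>V k\<close> cancels against the
    corresponding block of \<open>T_mat\<close>.\<close>
  also have "\<dots> = block_diag N H" using HTT by (rule block_diag_cong)
  also have "\<dots> = block_diag N (\<lambda>k. mat_adjoint (P k)) * block_diag N E'"
    unfolding H_def by (rule block_diag_mult[OF Pa E(2), symmetric])
  finally have VT: "mat_inv (V_mat n N U Q (mat_diag n \<mu>) P) * T_mat n N U Q =
      block_diag N (\<lambda>k. mat_adjoint (P k)) * block_diag N E'" .

  let ?S = "S_mat n N (\<lambda>k. mat_diag n (\<nu> k))"
  have S: "?S \<in> carrier_mat (n * N) (n * N)" by (simp add: S_mat_def)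
  \<comment> \<open>Scaling block row \<open>k\<close> by \<open>r i ^ (N - k)\<close> merges with
    the negative powers of the roots in \<open>S_mat\<close>, leaving powers of these quotients of
    modulus 1.\<close>
  define w where "w l i = r i / \<nu> l i" for l i
  have \<nu>0: "\<nu> l i \<noteq> 0" if "l \<in> {1..N}" "i < n" for l i using \<nu>r[OF that] r[OF that(2)] by auto
  have "block_diag N E' * ?S = mat (n * N) (n * N) (\<lambda>(i,j).
    if i mod n = j mod n then w (Suc (j div n)) (i mod n) ^ (N - Suc (i div n)) / sqrt (real N) else 0)"
    unfolding E'_def block_diag_mat_diag mat_diag_mult_left[OF S]
  proof (rule cong_mat[OF refl refl], unfold prod.case)
    fix i j assume ij: "i < n * N" "j < n * N"
    then have n: "n > 0" by (cases n) auto
    \<comment> \<open>The block number must be in range for the roots in it to be nonzero, and hence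
      for the inverse to be given by reciprocals.\<close>
    have "j div n + 1 \<in> {1..N}" using ij block_index_less[OF n, of j N] by auto
    then have inv: "mat_inv (mat_diag n (\<nu> (j div n + 1))) = mat_diag n (\<lambda>i. inverse (\<nu> (j div n + 1) i))"
      using \<nu>0 by (intro mat_inv_mat_diag) blast
    have "?S $$ (i,j) = (1 / sqrt (real N)) *
        (mat_inv (mat_diag n (\<nu> (j div n + 1))) ^\<^sub>m (N - (i div n + 1))) $$ (i mod n, j mod n)"
      using ij by (simp add: S_mat_def)
    also have "\<dots> = (if i mod n = j mod n
        then inverse (\<nu> (Suc (j div n)) (j mod n)) ^ (N - Suc (i div n)) / sqrt (real N) else 0)"
      unfolding inv mat_diag_pow using n by (simp add: mat_diag_def)
    finally have "?S $$ (i,j) = \<dots>" .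
    then show "complex_of_real (r (i mod n) ^ (N - Suc (i div n))) * ?S $$ (i,j) =
        (if i mod n = j mod n
         then w (Suc (j div n)) (i mod n) ^ (N - Suc (i div n)) / sqrt (real N) else 0)"
      by (simp add: w_def divide_inverse power_inverse power_mult_distrib)
  qed
  also have "unitary_mat \<dots>"
  proof (rule unitary_fourier_blocks)
    fix l m assume "l \<in> {1..N}" "m < n"
    then show "cmod (w l m) = 1" using \<nu>r[of l m] r[of m] by (simp add: w_def norm_divide)
  next
    fix m d :: nat assume m: "m < n" and d: "0 < d" "d < N"
    \<comment> \<open>Since \<open>\<nu> l m\<close> has modulus \<open>r m\<close>, its reciprocal
      is a multiple of its conjugate. This reduces power sums of \<open>w\<close> to power sums of
      the roots themselves, which \<open>sum_nth_roots_power\<close> handles.\<close>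
    have "w l m = cnj (\<nu> l m) / r m" if "l \<in> {1..N}" for l
    proof -
      have "\<nu> l m * cnj (\<nu> l m) = of_real (r m) * of_real (r m)"
        using \<nu>r[OF that m] by (simp add: power2_eq_square flip: complex_norm_square)
      then show ?thesis using \<nu>0[OF that m] r[OF m] by (simp add: w_def field_simps)
    qed
    then have "(\<Sum>l=1..N. w l m ^ d) = cnj (\<Sum>l=1..N. \<nu> l m ^ d) / r m ^ d"
      by (simp add: power_divide sum_divide_distrib)
    also have "(\<Sum>l=1..N. \<nu> l m ^ d) = (\<Sum>z | z ^ N = \<mu> m. z ^ d)"
      by (rule sum.reindex_bij_betw[OF \<nu>[OF m]])
    finally show "(\<Sum>l=1..N. w l m ^ d) = 0" using sum_nth_roots_power[OF d] by simp
  qed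
  finally have uES: "unitary_mat (block_diag N E' * ?S)" .
  have bE: "block_diag N E' \<in> carrier_mat (n * N) (n * N)" using E(2) by (rule block_diag_carrier)
  have bP: "block_diag N (\<lambda>k. mat_adjoint (P k)) \<in> carrier_mat (n * N) (n * N)"
    using Pa by (rule block_diag_carrier)
  have "unitary_mat (block_diag N (\<lambda>k. mat_adjoint (P k)))"
    by (rule block_diag_unitary[OF Pa unitary_mat_adjoint[OF P(2,1)]])
  \<comment> \<open>The remaining factor is block diagonal with the unitary blocks
    \<open>mat_adjoint (P k)\<close>.\<close>
  then have "unitary_mat (block_diag N (\<lambda>k. mat_adjoint (P k)) * (block_diag N E' * ?S))"
    using bP uES mult_carrier_mat[OF bE S] by (rule unitary_mat_mult)
  then have unitary: "unitary_mat (mat_inv (V_mat n N U Q (mat_diag n \<mu>) P) * T_mat n N U Q * ?S)"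
    by (simp add: VT assoc_mult_mat[OF bP bE S])

  \<comment> \<open>Norm of the transformed tuple: every component contributes equally\<close>
  have frob: "frob_norm_sq (U_tilde N U V k) = (\<Sum>i<n. (r i)\<^sup>2)" if k: "k \<in> {1..N}" for k
  proof -
    \<comment> \<open>\<open>k'\<close> is the cyclic successor of \<open>k\<close>, and
      \<open>c\<close> records the eigenvalues picked up only when the cycle closes at
      \<open>k = N\<close>.\<close>
    define k' where "k' = (if k = N then 1 else Suc k)"
    define c where "c = (if k = N then \<mu> else (\<lambda>_. 1))"
    have k': "k' \<in> {1..N}" using k N by (auto simp: k'_def)
    \<comment> \<open>For \<open>k < N\<close> the factor \<open>U k\<close> extends the segment
      product to the left. At \<open>k = N\<close> the whole cyclic product appears, and its
      diagonalization moves the eigenvalues to the right of \<open>Q\<close>, which is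
      \<open>T N\<close>.\<close>
    have UT: "U k * T k' = T k * mat_diag n c"
    proof (cases "k = N")
      case True
      have "U N * T 1 = U N * seg_prod n U 1 N * Q"
        using Uc[of N] N seg[of 1] Q by (simp add: T_def assoc_mult_mat[of _ n n _ n _ n])
      also have "\<dots> = Q * mat_diag n \<mu> * (mat_inv Q * Q)"
        unfolding assms(5) using Q(1) Qi(1) by (intro assoc_mult_mat[of _ n n _ n _ n]) auto
      also have "\<dots> = T N * mat_diag n \<mu>"
        using Q(1) Qi(2) by (simp add: T_def seg_prod_self right_mult_one_mat[of _ n])
      finally show ?thesis using True by (simp add: k'_def c_def)
    next
      case False
      then have "seg_prod n U k N = U k * seg_prod n U (Suc k) N" using k by (simp add: seg_prod_Cons)
      then show ?thesis
        using False k Uc[OF k] seg[of "Suc k"] Q(1) T(1)[OF k]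
        by (simp add: k'_def c_def T_def assoc_mult_mat[of _ n n _ n _ n])
    qed
    have inv: "mat_inv (V k) = H k * mat_inv (T k)"
      by (rule mat_inv_eqI[OF V[OF k] HT[OF k] HTV[OF k]])
    have "U_tilde N U V k = (H k * mat_inv (T k)) * U k * (T k' * G k')"
      using inv VTG[OF k'] by (simp add: U_tilde_def k'_def)
    also have "\<dots> = (H k * mat_inv (T k)) * (U k * T k') * G k'"
      using HT[OF k] Uc[OF k] T(1)[OF k'] G[OF k'] by (rule mult_mat_assoc4)
    also have "\<dots> = (H k * mat_inv (T k) * T k) * mat_diag n c * G k'"
      unfolding UT using HT[OF k] T(1)[OF k] by (simp add: assoc_mult_mat[of _ n n _ n _ n])
    \<comment> \<open>Only diagonal matrices remain between two unitary factors, and these do not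
      affect the Frobenius norm.\<close>
    also have "\<dots> = mat_adjoint (P k) * (E' k * mat_diag n c * E k') * P k'"
      unfolding HTT[OF k] unfolding H_def G_def using Pa[OF k] P(1)[OF k'] E[of k] E[of k']
      by (simp add: assoc_mult_mat[of _ n n _ n _ n] mult_carrier_mat[of _ n n _ n])
    also have "E' k * mat_diag n c * E k' =
        mat_diag n (\<lambda>i. complex_of_real (r i ^ (N - k)) * c i * complex_of_real (inverse (r i ^ (N - k'))))"
      by (simp add: E_def E'_def)
    finally have "frob_norm_sq (U_tilde N U V k) =
        frob_norm_sq (mat_diag n (\<lambda>i. complex_of_real (r i ^ (N - k)) * c i *
          complex_of_real (inverse (r i ^ (N - k')))))"
      using frob_norm_sq_mult_unitary_right[OF _ P[OF k']]
        frob_norm_sq_mult_unitary_left[OF _ Pa[OF k] unitary_mat_adjoint[OF P(2,1)[OF k]]] Pa[OF k]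
      by simp
    also have "\<dots> = (\<Sum>i<n. (r i)\<^sup>2)"
      unfolding frob_norm_sq_mat_diag
    proof (intro sum.cong refl arg_cong[of _ _ "\<lambda>x. x\<^sup>2"])
      fix i assume "i \<in> {..<n}"
      then have i: "i < n" by simp
      have "cmod (complex_of_real (r i ^ (N - k)) * c i * complex_of_real (inverse (r i ^ (N - k')))) =
          r i ^ (N - k) * cmod (c i) / r i ^ (N - k')"
        using r[OF i] by (simp add: norm_mult norm_power norm_inverse divide_inverse)
      \<comment> \<open>For \<open>k < N\<close> this is a quotient of consecutive powers of
        \<open>r i\<close>; for \<open>k = N\<close> it is the modulus \<open>r i ^ N\<close> of the
        eigenvalue divided by \<open>r i ^ (N - 1)\<close>.\<close>
      also have "\<dots> = r i"
      proof (cases "k = N")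
        case True
        have "r i ^ N = r i * r i ^ (N - 1)" using N by (cases N) auto
        then show ?thesis using True r[OF i] rN[OF i] by (simp add: c_def k'_def)
      next
        case False
        then have "N - k = Suc (N - k')" using k by (auto simp: k'_def)
        then show ?thesis using False r[OF i] by (simp add: c_def)
      qed
      finally show "cmod (complex_of_real (r i ^ (N - k)) * c i *
        complex_of_real (inverse (r i ^ (N - k')))) = r i" .
    qed
    finally show ?thesis .
  qed
  have "tuple_norm N (U_tilde N U V) = sqrt (real N * (\<Sum>i<n. (r i)\<^sup>2))"
    using frob by (simp add: tuple_norm_def)
  also have "(\<Sum>i<n. (r i)\<^sup>2) = (\<Sum>i<n. cmod (\<mu> i) powr (2 / real N))"
    by (simp add: r_def power2_eq_square flip: powr_add)
  finally show ?thesis using unitary by (simp add: V_def)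
qed

end
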